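(* Consider the one-dimensional all-topology two-fluid system described in the context. When the system is out of resonance, i.e. $u\neq u_k\pm c_k$ for $k=1,2$ (both signs), the characteristic fields associated to the convective eigenvalues $u$ and $u_k$, $k=1,2$, are linearly degenerate. Moreover, for $k=1,2$, if the equation of state of the $k$-th phase is such that $\mathcal{G}_k\neq0$, then the characteristic fields associated to the acoustic eigenvalues $u_k\pm c_k$ are genuinely non-linear. Here $\mathcal{G}_k$ is the fundamental derivative $$\mathcal{G}_k=-\frac{\tau_k}{2}\,\frac{\left.\partial^3e_k/\partial\tau_k^3\right|_{s_k}}{\left.\partial^2e_k/\partial\tau_k^2\right|_{s_k}} .$$
   Context: Thermodynamics: for each phase $k=1,2$ a complete equation of state is given by a smooth strictly concave function $(\tau_k,e_k)\mapsto s_k$, where $\rho_k>0$ is the density, $\tau_k=1/\rho_k$ the specific volume, $e_k$ the specific internal energy and $s_k$ the specific entropy. The Gibbs identity $T_k\,\mathrm{d}s_k=\mathrm{d}e_k+p_k\,\mathrm{d}\tau_k$ defines the temperature $T_k>0$ and the pressure $p_k$. The sound velocity is $c_k=\sqrt{\left.\partial p_k/\partial\rho_k\right|_{s_k}}>0$. Notation: $u_k\in\mathbb{R}$ is the velocity of phase $k$; $\alpha_1\in(0,1)$ is the volume fraction of phase 1 and $\alpha_2=1-\alpha_1$; $\rho=\alpha_1\rho_1+\alpha_2\rho_2$; $Y_k=\alpha_k\rho_k/\rho$; $u=Y_1u_1+Y_2u_2$; $E_k=e_k+u_k^2/2$; $H_k=E_k+p_k/\rho_k$; interfacial pressure $p_I=Y_2p_1+Y_1p_2$;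 interfacial work $(pu)_I=Y_1p_2u_1+Y_2p_1u_2$. System (one space dimension, no source terms): $$\partial_t\alpha_1+u\,\partial_x\alpha_1=0,$$ $$\partial_t(\alpha_k\rho_k)+\partial_x(\alpha_k\rho_ku_k)=0,\quad k=1,2,$$ $$\partial_t(\alpha_1\rho_1u_1)+\partial_x(\alpha_1\rho_1u_1^2+\alpha_1p_1)-p_I\partial_x\alpha_1=0,$$ $$\partial_t(\alpha_2\rho_2u_2)+\partial_x(\alpha_2\rho_2u_2^2+\alpha_2p_2)+p_I\partial_x\alpha_1=0,$$ $$\partial_t(\alpha_1\rho_1E_1)+\partial_x(\alpha_1\rho_1H_1u_1)-(pu)_I\partial_x\alpha_1=0,$$ $$\partial_t(\alpha_2\rho_2E_2)+\partial_x(\alpha_2\rho_2H_2u_2)+(pu)_I\partial_x\alpha_1=0.$$ Its quasilinear form, for smooth solutions, in any set $\boldsymbol{U}$ of seven independent state variables, e.g. $\boldsymbol{U}=(\alpha_1,u_1,p_1,s_1,u_2,p_2,s_2)$, is $\partial_t\boldsymbol{U}+\mathbf{M}(\boldsymbol{U})\partial_x\boldsymbol{U}=\boldsymbol{0}$. Its seven eigenvalues, as functions on state space, are $u$, $u_1$, $u_1\pm c_1$, $u_2$, $u_2\pm c_2$. Each is associated, away from resonance, with a smooth eigenvector field $\boldsymbol{r}(\boldsymbol{U})$, the seven eigenvector fields forming a basis of $\mathbb{R}^7$. A characteristic field $(\lambda,\boldsymbol{r})$ is linearly degenerate if $\nabla_{\boldsymbol{U}}\lambda\cdot\boldsymbol{r}=0$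 identically, and genuinely non-linear if $\nabla_{\boldsymbol{U}}\lambda\cdot\boldsymbol{r}\neq0$ everywhere; these notions do not depend on the choice of variables. *)

theory Defs
  imports "HOL-Analysis.Analysis"
begin

text \<open>Differentiability classes on open sets.\<close>

fun differentiable_order ::
  "nat \<Rightarrow> 'a::real_normed_vector set \<Rightarrow> ('a \<Rightarrow> 'b::real_normed_vector) \<Rightarrow> bool" where
  "differentiable_order 0 S f \<longleftrightarrow> continuous_on S f"
| "differentiable_order (Suc n) S f \<longleftrightarrow>
     (\<forall>x\<in>S. f differentiable (at x)) \<and>
     (\<forall>v. differentiable_order n S (\<lambda>x. frechet_derivative f (at x) v))"

definition smooth_on :: "'a::real_normed_vector set \<Rightarrow> ('a \<Rightarrow> 'b::real_normed_vector) \<Rightarrow> bool" where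
  "smooth_on S f \<longleftrightarrow> (\<forall>n. differentiable_order n S f)"

definition strictly_concave_on :: "'a::real_vector set \<Rightarrow> ('a \<Rightarrow> real) \<Rightarrow> bool" where
  "strictly_concave_on S f \<longleftrightarrow> convex S \<and>
     (\<forall>x\<in>S. \<forall>y\<in>S. \<forall>t. x \<noteq> y \<and> 0 < t \<and> t < 1 \<longrightarrow>
        (1 - t) * f x + t * f y < f ((1 - t) *\<^sub>R x + t *\<^sub>R y))"


section \<open>Thermodynamics of one phase\<close>

text \<open>An equation of state is the function \<open>(\<tau>, e) \<mapsto> s\<close> together with its domain.\<close>

record eos =
  eos_dom :: "(real \<times> real) set"
  entropy :: "real \<times> real \<Rightarrow> real"

text \<open>The Gibbs identity \<open>T ds = de + p d\<tau>\<close> says that the partial derivatives of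
  \<open>s(\<tau>, e)\<close> with respect to \<open>e\<close> and \<open>\<tau>\<close> are \<open>1 / T\<close> and \<open>p / T\<close>.\<close>

definition temperature :: "eos \<Rightarrow> real \<times> real \<Rightarrow> real" where
  "temperature X x = 1 / frechet_derivative (entropy X) (at x) (0, 1)"

definition pressure :: "eos \<Rightarrow> real \<times> real \<Rightarrow> real" where
  "pressure X x = temperature X x * frechet_derivative (entropy X) (at x) (1, 0)"

text \<open>The internal energy as a function of \<open>(\<tau>, s)\<close>; it is well defined because
  \<open>s(\<tau>, e)\<close> is strictly increasing in \<open>e\<close> when \<open>T > 0\<close>. Derivatives at constant
  entropy are derivatives along \<open>\<tau> \<mapsto> (\<tau>, e(\<tau>, s))\<close> with \<open>s\<close> fixed.\<close>

definition energy :: "eos \<Rightarrow> real \<Rightarrow> real \<Rightarrow> real" where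
  "energy X \<tau> s = (THE e. (\<tau>, e) \<in> eos_dom X \<and> entropy X (\<tau>, e) = s)"

definition sound_speed :: "eos \<Rightarrow> real \<times> real \<Rightarrow> real" where
  "sound_speed X x =
     sqrt (deriv (\<lambda>\<rho>. pressure X (1 / \<rho>, energy X (1 / \<rho>) (entropy X x))) (1 / fst x))"

definition fundamental_derivative :: "eos \<Rightarrow> real \<times> real \<Rightarrow> real" where
  "fundamental_derivative X x =
     (let \<epsilon> = (\<lambda>\<tau>. energy X \<tau> (entropy X x))
      in - (fst x / 2) * ((deriv ^^ 3) \<epsilon> (fst x) / (deriv ^^ 2) \<epsilon> (fst x)))"

definition complete_eos :: "eos \<Rightarrow> bool" where
  "complete_eos X \<longleftrightarrow>
     open (eos_dom X) \<and>
     (\<forall>x\<in>eos_dom X. fst x > 0) \<and>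
     smooth_on (eos_dom X) (entropy X) \<and>
     strictly_concave_on (eos_dom X) (entropy X) \<and>
     (\<forall>x\<in>eos_dom X. temperature X x > 0 \<and> sound_speed X x > 0)"


section \<open>The two-fluid system\<close>

datatype phase = Ph1 | Ph2

text \<open>A physical state is \<open>(\<alpha>\<^sub>1, (\<tau>\<^sub>1, u\<^sub>1, e\<^sub>1), (\<tau>\<^sub>2, u\<^sub>2, e\<^sub>2))\<close>. These coordinates only serve to
  describe a state; the set of variables in which the quasilinear form is written is arbitrary,
  see \<open>state_variables\<close> below.\<close>

type_synonym state = "real \<times> (real \<times> real \<times> real) \<times> (real \<times> real \<times> real)"

fun vol_frac :: "phase \<Rightarrow> state \<Rightarrow> real" where
  "vol_frac Ph1 z = fst z"
| "vol_frac Ph2 z = 1 - fst z"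

fun phase_state :: "phase \<Rightarrow> state \<Rightarrow> real \<times> real \<times> real" where
  "phase_state Ph1 z = fst (snd z)"
| "phase_state Ph2 z = snd (snd z)"

definition vel :: "phase \<Rightarrow> state \<Rightarrow> real" where
  "vel k z = fst (snd (phase_state k z))"

definition thermo :: "phase \<Rightarrow> state \<Rightarrow> real \<times> real" where
  "thermo k z = (fst (phase_state k z), snd (snd (phase_state k z)))"

definition admissible :: "(phase \<Rightarrow> eos) \<Rightarrow> state set" where
  "admissible X = {z. 0 < vol_frac Ph1 z \<and> vol_frac Ph1 z < 1 \<and>
                      (\<forall>k. thermo k z \<in> eos_dom (X k))}"

definition dens :: "phase \<Rightarrow> state \<Rightarrow> real" where
  "dens k z = 1 / fst (thermo k z)"

definition part_dens :: "phase \<Rightarrow> state \<Rightarrow> real" where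
  "part_dens k z = vol_frac k z * dens k z"

definition mix_dens :: "state \<Rightarrow> real" where
  "mix_dens z = part_dens Ph1 z + part_dens Ph2 z"

definition mass_frac :: "phase \<Rightarrow> state \<Rightarrow> real" where
  "mass_frac k z = part_dens k z / mix_dens z"

definition mix_vel :: "state \<Rightarrow> real" where
  "mix_vel z = mass_frac Ph1 z * vel Ph1 z + mass_frac Ph2 z * vel Ph2 z"

definition press :: "(phase \<Rightarrow> eos) \<Rightarrow> phase \<Rightarrow> state \<Rightarrow> real" where
  "press X k z = pressure (X k) (thermo k z)"

definition sound :: "(phase \<Rightarrow> eos) \<Rightarrow> phase \<Rightarrow> state \<Rightarrow> real" where
  "sound X k z = sound_speed (X k) (thermo k z)"

definition total_energy :: "phase \<Rightarrow> state \<Rightarrow> real" where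
  "total_energy k z = snd (thermo k z) + (vel k z)\<^sup>2 / 2"

definition total_enthalpy :: "(phase \<Rightarrow> eos) \<Rightarrow> phase \<Rightarrow> state \<Rightarrow> real" where
  "total_enthalpy X k z = total_energy k z + press X k z / dens k z"

definition interf_press :: "(phase \<Rightarrow> eos) \<Rightarrow> state \<Rightarrow> real" where
  "interf_press X z = mass_frac Ph2 z * press X Ph1 z + mass_frac Ph1 z * press X Ph2 z"

definition interf_work :: "(phase \<Rightarrow> eos) \<Rightarrow> state \<Rightarrow> real" where
  "interf_work X z = mass_frac Ph1 z * press X Ph2 z * vel Ph1 z
                   + mass_frac Ph2 z * press X Ph1 z * vel Ph2 z"

text \<open>The system has the form \<open>\<partial>\<^sub>t W(z) + \<partial>\<^sub>x F(z) + B(z) \<partial>\<^sub>x \<alpha>\<^sub>1 = 0\<close>, with the seven equations ordered as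
  volume fraction; mass, momentum, energy of phase 1; mass, momentum, energy of phase 2.\<close>

type_synonym equations = "real \<times> (real \<times> real \<times> real) \<times> (real \<times> real \<times> real)"

definition conserved :: "state \<Rightarrow> equations" where
  "conserved z =
     (let w = (\<lambda>k. (part_dens k z, part_dens k z * vel k z, part_dens k z * total_energy k z))
      in (vol_frac Ph1 z, w Ph1, w Ph2))"

definition flux :: "(phase \<Rightarrow> eos) \<Rightarrow> state \<Rightarrow> equations" where
  "flux X z =
     (let f = (\<lambda>k. (part_dens k z * vel k z,
                    part_dens k z * (vel k z)\<^sup>2 + vol_frac k z * press X k z,
                    part_dens k z * total_enthalpy X k z * vel k z))
      in (0, f Ph1, f Ph2))"

definition nonconservative :: "(phase \<Rightarrow> eos) \<Rightarrow> state \<Rightarrow> equations" where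
  "nonconservative X z =
     (mix_vel z,
      (0, - interf_press X z, - interf_work X z),
      (0, interf_press X z, interf_work X z))"


section \<open>Quasilinear form and characteristic fields\<close>

text \<open>A set of seven independent state variables \<open>U\<close> ranging over \<open>D\<close>: the state is a smooth
  injective function \<open>\<Phi>\<close> of \<open>U\<close> with invertible differential.\<close>

definition state_variables ::
  "(phase \<Rightarrow> eos) \<Rightarrow> (real^7 \<Rightarrow> state) \<Rightarrow> (real^7) set \<Rightarrow> bool" where
  "state_variables X \<Phi> D \<longleftrightarrow>
     open D \<and> \<Phi> ` D \<subseteq> admissible X \<and> smooth_on D \<Phi> \<and> inj_on \<Phi> D \<and>
     (\<forall>U\<in>D. bij (frechet_derivative \<Phi> (at U)))"

text \<open>For a smooth solution \<open>U(t, x)\<close> the chain rule turns the system into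
  \<open>DW(U) \<partial>\<^sub>t U + (DF(U) + B(U) \<otimes> D\<alpha>\<^sub>1(U)) \<partial>\<^sub>x U = 0\<close>, whence
  \<open>M(U) = DW(U)\<^sup>-\<^sup>1 (DF(U) + B(U) \<otimes> D\<alpha>\<^sub>1(U))\<close>.\<close>

definition quasilinear_matrix ::
  "(phase \<Rightarrow> eos) \<Rightarrow> (real^7 \<Rightarrow> state) \<Rightarrow> real^7 \<Rightarrow> real^7^7" where
  "quasilinear_matrix X \<Phi> U = matrix (\<lambda>V.
     inv (frechet_derivative (conserved \<circ> \<Phi>) (at U))
       (frechet_derivative (flux X \<circ> \<Phi>) (at U) V
        + frechet_derivative (vol_frac Ph1 \<circ> \<Phi>) (at U) V *\<^sub>R nonconservative X (\<Phi> U)))"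

text \<open>Labels of the seven waves. The eigenvalues may coincide at some states.\<close>

datatype wave = Mixture | Convective phase | Acoustic_minus phase | Acoustic_plus phase

fun eigenvalue :: "(phase \<Rightarrow> eos) \<Rightarrow> wave \<Rightarrow> state \<Rightarrow> real" where
  "eigenvalue X Mixture z = mix_vel z"
| "eigenvalue X (Convective k) z = vel k z"
| "eigenvalue X (Acoustic_minus k) z = vel k z - sound X k z"
| "eigenvalue X (Acoustic_plus k) z = vel k z + sound X k z"

definition out_of_resonance :: "(phase \<Rightarrow> eos) \<Rightarrow> state \<Rightarrow> bool" where
  "out_of_resonance X z \<longleftrightarrow>
     (\<forall>k. mix_vel z \<noteq> vel k z - sound X k z \<and> mix_vel z \<noteq> vel k z + sound X k z)"

text \<open>Smooth eigenvector fields on \<open>G\<close>, one for each wave, forming a basis at every point. At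
  states where eigenvalues coincide a single eigenvector is not determined by its eigenvalue, so
  it is the smoothness of the fields that attaches them to their waves.\<close>

definition eigenvector_fields ::
  "(phase \<Rightarrow> eos) \<Rightarrow> (real^7 \<Rightarrow> state) \<Rightarrow> (real^7) set \<Rightarrow> (wave \<Rightarrow> real^7 \<Rightarrow> real^7) \<Rightarrow> bool" where
  "eigenvector_fields X \<Phi> G r \<longleftrightarrow>
     (\<forall>w. smooth_on G (r w)) \<and>
     (\<forall>w. \<forall>U\<in>G. quasilinear_matrix X \<Phi> U *v r w U = eigenvalue X w (\<Phi> U) *\<^sub>R r w U) \<and>
     (\<forall>U\<in>G. inj (\<lambda>w. r w U) \<and> independent (range (\<lambda>w. r w U)) \<and>
             span (range (\<lambda>w. r w U)) = UNIV)"

definition linearly_degenerate ::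
  "(real^7) set \<Rightarrow> (real^7 \<Rightarrow> real) \<Rightarrow> (real^7 \<Rightarrow> real^7) \<Rightarrow> bool" where
  "linearly_degenerate G l r \<longleftrightarrow>
     (\<forall>U\<in>G. l differentiable (at U) \<and> frechet_derivative l (at U) (r U) = 0)"

definition genuinely_nonlinear ::
  "(real^7) set \<Rightarrow> (real^7 \<Rightarrow> real) \<Rightarrow> (real^7 \<Rightarrow> real^7) \<Rightarrow> bool" where
  "genuinely_nonlinear G l r \<longleftrightarrow>
     (\<forall>U\<in>G. l differentiable (at U) \<and> frechet_derivative l (at U) (r U) \<noteq> 0)"

end

theory Submission
  imports Defs
begin

text \<open>For a tangent vector \<open>dU\<close> that is an eigenvector for the eigenvalue \<open>\<mu>\<close>, the mass balances read
  \<open>d(m\<^sub>k u\<^sub>k) = \<mu> dm\<^sub>k\<close> with \<open>m\<^sub>k = \<alpha>\<^sub>k \<rho>\<^sub>k\<close>. For \<open>\<mu> = u\<^sub>k\<close> this gives \<open>m\<^sub>k du\<^sub>k = 0\<close>, and for \<open>\<mu> = u\<close> the sum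
  over both phases gives \<open>\<rho> du = 0\<close>; so the convective fields are linearly degenerate.

  For \<open>\<mu> = u\<^sub>k + \<sigma> c\<^sub>k\<close>, \<open>\<sigma> = \<plusminus>1\<close>, absence of resonance gives \<open>d\<alpha>\<^sub>1 = 0\<close>, so each phase satisfies the
  linearised Euler equations: \<open>de\<^sub>k = - p\<^sub>k d\<tau>\<^sub>k\<close> and \<open>du\<^sub>k = - \<sigma> c\<^sub>k d\<tau>\<^sub>k / \<tau>\<^sub>k\<close>. With \<open>c\<^sub>k = \<tau>\<^sub>k \<surd>q\<close>, where
  \<open>q\<close> is the second derivative of the energy at constant entropy, \<open>d\<mu> = \<sigma> \<tau>\<^sub>k q' d\<tau>\<^sub>k / (2 \<surd>q)
  = - \<sigma> G\<^sub>k \<surd>q d\<tau>\<^sub>k\<close>. Finally \<open>d\<tau>\<^sub>k \<noteq> 0\<close>, because the component of the eigenvector in the other phase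
  vanishes where the eigenvalues of the two phases differ, hence everywhere by continuity.\<close>

subsection \<open>Smoothness and partial derivatives\<close>

lemma smooth_on_differentiable:
  assumes "smooth_on S f" "x \<in> S"
  shows "f differentiable (at x)"
  using assms differentiable_order.simps(2)[of 0 S f] unfolding smooth_on_def by blast

lemma smooth_on_frechet_derivative:
  assumes "smooth_on S f"
  shows "smooth_on S (\<lambda>x. frechet_derivative f (at x) v)"
  using assms differentiable_order.simps(2)[of _ S f] unfolding smooth_on_def by blast

lemma smooth_on_imp_continuous_on:
  assumes "smooth_on S f"
  shows "continuous_on S f"
  using assms differentiable_order.simps(1)[of S f] unfolding smooth_on_def by blast

lemma linear_frechet_derivative_real_prod:
  fixes f :: "real \<times> real \<Rightarrow> real"
  assumes "f differentiable (at x)"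
  shows "frechet_derivative f (at x) h
    = fst h * frechet_derivative f (at x) (1, 0) + snd h * frechet_derivative f (at x) (0, 1)"
proof -
  interpret linear "frechet_derivative f (at x)"
    using assms by (rule linear_frechet_derivative)
  have "h = fst h *\<^sub>R (1, 0) + snd h *\<^sub>R (0, 1)"
    by (simp add: prod_eq_iff)
  then have "frechet_derivative f (at x) h
      = frechet_derivative f (at x) (fst h *\<^sub>R (1, 0) + snd h *\<^sub>R (0, 1))"
    by simp
  also have "\<dots> = fst h * frechet_derivative f (at x) (1, 0) + snd h * frechet_derivative f (at x) (0, 1)"
    by (simp only: add scale real_scaleR_def)
  finally show ?thesis .
qed


subsection \<open>Isentropes of a complete equation of state\<close>

text \<open>The derivative along an isentrope, whose slope \<open>de/d\<tau>\<close> is \<open>-p\<close>.\<close>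

definition isentropic_derivative :: "eos \<Rightarrow> (real \<times> real \<Rightarrow> real) \<Rightarrow> real \<times> real \<Rightarrow> real" where
  "isentropic_derivative X f x = frechet_derivative f (at x) (1, - pressure X x)"

text \<open>The second derivative of the energy at constant entropy, as a function of \<open>(\<tau>, e)\<close>.\<close>

definition stiffness :: "eos \<Rightarrow> real \<times> real \<Rightarrow> real" where
  "stiffness X x = - isentropic_derivative X (pressure X) x"

locale complete_phase =
  fixes X :: eos
  assumes complete: "complete_eos X"
begin

abbreviation dom where "dom \<equiv> eos_dom X"
abbreviation s_tau where "s_tau \<equiv> \<lambda>x. frechet_derivative (entropy X) (at x) (1, 0)"
abbreviation s_e where "s_e \<equiv> \<lambda>x. frechet_derivative (entropy X) (at x) (0, 1)"

lemma open_dom: "open dom" and fst_pos: "x \<in> dom \<Longrightarrow> fst x > 0"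
  and smooth_entropy: "smooth_on dom (entropy X)" and convex_dom: "convex dom"
  and temperature_pos: "x \<in> dom \<Longrightarrow> temperature X x > 0"
  and sound_speed_pos: "x \<in> dom \<Longrightarrow> sound_speed X x > 0"
  using complete unfolding complete_eos_def strictly_concave_on_def by auto

lemma s_e_pos: "x \<in> dom \<Longrightarrow> s_e x > 0"
  using temperature_pos[of x] by (simp add: temperature_def)

lemma pressure_eq: "pressure X x = s_tau x / s_e x"
  by (simp add: pressure_def temperature_def)

lemma has_derivative_entropy:
  "x \<in> dom \<Longrightarrow> (entropy X has_derivative frechet_derivative (entropy X) (at x)) (at x)"
  using smooth_on_differentiable[OF smooth_entropy] by (simp add: frechet_derivative_works)

lemma has_derivative_partial_entropy:
  assumes "x \<in> dom"
  shows "((\<lambda>x. frechet_derivative (entropy X) (at x) v) has_derivative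
    frechet_derivative (\<lambda>x. frechet_derivative (entropy X) (at x) v) (at x)) (at x)"
  using smooth_on_differentiable[OF smooth_on_frechet_derivative[OF smooth_entropy] assms]
  by (simp add: frechet_derivative_works)

text \<open>The quotient rule for p = s_tau / s_e. The explicit form shows that directional
  derivatives of the pressure are again quotients of smooth functions, which is what differentiating
  the stiffness requires.\<close>

lemma has_derivative_pressure:
  assumes "x \<in> dom"
  shows "(pressure X has_derivative
    (\<lambda>h. (frechet_derivative s_tau (at x) h * s_e x - s_tau x * frechet_derivative s_e (at x) h)
       / (s_e x * s_e x))) (at x)"
  using has_derivative_divide'[OF has_derivative_partial_entropy[OF assms, of "(1,0)"]
      has_derivative_partial_entropy[OF assms, of "(0,1)"]] s_e_pos[OF assms]
  by (simp add: pressure_eq[abs_def])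

lemma differentiable_pressure: "x \<in> dom \<Longrightarrow> pressure X differentiable (at x)"
  using has_derivative_pressure differentiableI by blast

text \<open>The stiffness is built from second derivatives of the entropy, so its differential
  involves third derivatives, which smoothness of the entropy provides.\<close>

lemma differentiable_stiffness:
  assumes "x \<in> dom"
  shows "stiffness X differentiable (at x)"
proof -
  have D: "(\<lambda>x. frechet_derivative (pressure X) (at x) v) differentiable (at x)" for v
  proof -
    let ?D = "\<lambda>x. (frechet_derivative s_tau (at x) v * s_e x
        - s_tau x * frechet_derivative s_e (at x) v) / (s_e x * s_e x)"
    note d = smooth_on_differentiable[OF _ assms] smooth_on_frechet_derivative smooth_entropy
    have "?D differentiable (at x)"
      using s_e_pos[OF assms] by (intro derivative_intros d) auto
    then obtain D' where "(?D has_derivative D') (at x)"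
      unfolding differentiable_def by blast
    then have "((\<lambda>x. frechet_derivative (pressure X) (at x) v) has_derivative D') (at x)"
      by (rule has_derivative_transform_within_open[OF _ open_dom assms])
        (simp flip: frechet_derivative_at[OF has_derivative_pressure])
    then show ?thesis by (rule differentiableI)
  qed
  \<comment> \<open>The direction (1, -p) in \<open>isentropic_derivative\<close> varies with the
    point. Splitting it by linearity leaves derivatives of the pressure in fixed directions, which
    \<open>D\<close> covers.\<close>
  let ?q = "\<lambda>x. pressure X x * frechet_derivative (pressure X) (at x) (0, 1)
    - frechet_derivative (pressure X) (at x) (1, 0)"
  have "?q differentiable (at x)"
    by (intro derivative_intros D differentiable_pressure assms)
  then obtain D' where "(?q has_derivative D') (at x)"
    unfolding differentiable_def by blast
  then have "(stiffness X has_derivative D') (at x)"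
    apply (rule has_derivative_transform_within_open[OF _ open_dom assms])
    unfolding stiffness_def isentropic_derivative_def
    by (subst linear_frechet_derivative_real_prod[OF differentiable_pressure]) simp_all
  then show ?thesis by (rule differentiableI)
qed

section \<open>The energy as a function of specific volume and entropy\<close>

text \<open>Convexity of the domain keeps the whole segment from a to b inside it, and there ds/de =
  1/T is positive.\<close>

lemma entropy_strict_mono:
  assumes "(\<tau>, a) \<in> dom" "(\<tau>, b) \<in> dom" "a < b"
  shows "entropy X (\<tau>, a) < entropy X (\<tau>, b)"
proof (rule DERIV_pos_imp_increasing[OF \<open>a < b\<close>])
  fix t assume t: "a \<le> t" "t \<le> b"
  have "(\<tau>, t) = (1 - (t - a) / (b - a)) *\<^sub>R (\<tau>, a) + ((t - a) / (b - a)) *\<^sub>R (\<tau>, b)"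
    using \<open>a < b\<close> by (simp add: divide_simps) (simp add: algebra_simps)
  moreover have "0 \<le> (t - a) / (b - a)" "(t - a) / (b - a) \<le> 1"
    using t \<open>a < b\<close> by (auto simp: divide_simps)
  ultimately have dom: "(\<tau>, t) \<in> dom"
    using convex_dom assms(1,2) by (simp only: convex_alt)
  have "((\<lambda>t. entropy X (\<tau>, t)) has_derivative
      (\<lambda>h. frechet_derivative (entropy X) (at (\<tau>, t)) (0, h))) (at t)"
    by (rule has_derivative_compose[of "\<lambda>t. (\<tau>, t)" "\<lambda>h. (0, h)", OF _ has_derivative_entropy[OF dom]])
      (auto intro!: derivative_eq_intros)
  moreover have "(\<lambda>h. frechet_derivative (entropy X) (at (\<tau>, t)) (0, h)) = (*) (s_e (\<tau>, t))"
    by (subst linear_frechet_derivative_real_prod[OF smooth_on_differentiable[OF smooth_entropy dom]])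
      (simp add: fun_eq_iff)
  ultimately show "\<exists>y. ((\<lambda>t. entropy X (\<tau>, t)) has_real_derivative y) (at t) \<and> 0 < y"
    using s_e_pos[OF dom] unfolding has_field_derivative_def by metis
qed

lemma entropy_inj:
  assumes "(\<tau>, a) \<in> dom" "(\<tau>, b) \<in> dom" "entropy X (\<tau>, a) = entropy X (\<tau>, b)"
  shows "a = b"
  using entropy_strict_mono[OF assms(1,2)] entropy_strict_mono[OF assms(2,1)] assms(3)
  by (metis less_irrefl linorder_neqE)

lemma energy_entropy:
  assumes "x \<in> dom"
  shows "energy X (fst x) (entropy X x) = snd x"
  unfolding energy_def
  by (rule the_equality) (use assms entropy_inj[of "fst x" _ "snd x"] in auto)

text \<open>The change of variables from (tau, e) to (tau, s). Its inverse on the image sends (tau,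
  s) to (tau, \<open>energy X \<tau> s\<close>).\<close>

definition entropy_chart :: "real \<times> real \<Rightarrow> real \<times> real" where
  "entropy_chart x = (fst x, entropy X x)"

lemma continuous_on_entropy_chart: "continuous_on dom entropy_chart"
  unfolding entropy_chart_def
  by (intro continuous_intros smooth_on_imp_continuous_on smooth_entropy)

text \<open>Invariance of domain applies to the continuous injective chart. Openness of the image is
  what lets an isentrope be followed for all tau near a given one.\<close>

lemma open_entropy_chart_image: "open (entropy_chart ` dom)"
proof (rule invariance_of_domain[OF continuous_on_entropy_chart open_dom])
  show "inj_on entropy_chart dom"
    using entropy_inj by (auto simp: inj_on_def entropy_chart_def)
qed

lemma energy_chart:
  assumes "(\<tau>, s) \<in> entropy_chart ` dom"
  shows "(\<tau>, energy X \<tau> s) \<in> dom" "entropy X (\<tau>, energy X \<tau> s) = s"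
proof -
  obtain x where "x \<in> dom" "fst x = \<tau>" "entropy X x = s"
    using assms by (auto simp: entropy_chart_def)
  then show "(\<tau>, energy X \<tau> s) \<in> dom" "entropy X (\<tau>, energy X \<tau> s) = s"
    using energy_entropy[of x] by (metis prod.collapse)+
qed

lemma eventually_isentrope:
  assumes "x \<in> dom"
  shows "\<forall>\<^sub>F \<tau> in nhds (fst x). (\<tau>, entropy X x) \<in> entropy_chart ` dom"
proof -
  have "((\<lambda>\<tau>. (\<tau>, entropy X x)) \<longlongrightarrow> (fst x, entropy X x)) (nhds (fst x))"
    by (intro tendsto_intros filterlim_ident)
  moreover have "(fst x, entropy X x) \<in> entropy_chart ` dom"
    using assms by (auto simp: entropy_chart_def)
  ultimately show ?thesis
    using open_entropy_chart_image topological_tendstoD by blast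
qed

text \<open>The inverse function theorem for the chart; setting ds = 0 in T ds = de + p dtau leaves
  de = -p dtau.\<close>

lemma has_real_derivative_energy:
  assumes "x \<in> dom"
  shows "((\<lambda>\<tau>. energy X \<tau> (entropy X x)) has_real_derivative - pressure X x) (at (fst x))"
proof -
  let ?g = "\<lambda>y. (fst y, energy X (fst y) (snd y))"
  \<comment> \<open>The inverse of the differential of the chart: ds = s_tau dtau + s_e de is solved
    for de.\<close>
  let ?g' = "\<lambda>k. (fst k, (snd k - fst k * s_tau x) / s_e x)"
  have "(?g has_derivative ?g') (at (entropy_chart x))"
  proof (rule has_derivative_inverse_strong[OF open_dom assms continuous_on_entropy_chart])
    show "?g (entropy_chart y) = y" if "y \<in> dom" for y
      using energy_entropy[OF that] by (simp add: entropy_chart_def)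
    show "(entropy_chart has_derivative (\<lambda>h. (fst h, frechet_derivative (entropy X) (at x) h))) (at x)"
      unfolding entropy_chart_def
      by (intro has_derivative_Pair has_derivative_fst has_derivative_ident has_derivative_entropy assms)
    show "(\<lambda>h. (fst h, frechet_derivative (entropy X) (at x) h)) \<circ> ?g' = id"
      using s_e_pos[OF assms]
      by (auto simp: fun_eq_iff
        linear_frechet_derivative_real_prod[OF smooth_on_differentiable[OF smooth_entropy assms],
          of "(_, _ / _)"])
  qed
  then have "((\<lambda>y. energy X (fst y) (snd y)) has_derivative (\<lambda>k. snd (?g' k)))
      (at (fst x, entropy X x))"
    unfolding entropy_chart_def by (auto dest: has_derivative_snd)
  then have "((\<lambda>\<tau>. energy X (fst (\<tau>, entropy X x)) (snd (\<tau>, entropy X x))) has_derivative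
      (\<lambda>h. snd (?g' (h, 0)))) (at (fst x))"
    by (rule has_derivative_compose[of "\<lambda>\<tau>. (\<tau>, entropy X x)" "\<lambda>h. (h, 0)", rotated])
      (auto intro!: derivative_eq_intros)
  then show ?thesis
    by (simp add: has_field_derivative_def pressure_eq fun_eq_iff)
      (erule has_derivative_eq_rhs, auto)
qed

text \<open>The chain rule along the isentrope through x, whose tangent there is (1, -p).\<close>

lemma has_real_derivative_isentrope:
  assumes "x \<in> dom" "f differentiable (at x)"
  shows "((\<lambda>\<tau>. f (\<tau>, energy X \<tau> (entropy X x))) has_real_derivative isentropic_derivative X f x)
    (at (fst x))"
proof -
  interpret linear "frechet_derivative f (at x)"
    using assms(2) by (rule linear_frechet_derivative)
  have "((\<lambda>\<tau>. (\<tau>, energy X \<tau> (entropy X x))) has_derivative (\<lambda>h. (h, - pressure X x * h)))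
      (at (fst x))"
    using has_real_derivative_energy[OF assms(1)]
    unfolding has_field_derivative_def by (rule has_derivative_Pair[OF has_derivative_ident])
  moreover have "(f has_derivative frechet_derivative f (at x))
      (at (fst x, energy X (fst x) (entropy X x)))"
    using assms by (simp add: energy_entropy frechet_derivative_works)
  ultimately have "((\<lambda>\<tau>. f (\<tau>, energy X \<tau> (entropy X x))) has_derivative
      (\<lambda>h. frechet_derivative f (at x) (h, - pressure X x * h))) (at (fst x))"
    by (rule has_derivative_compose)
  moreover have "frechet_derivative f (at x) (h, - pressure X x * h)
      = isentropic_derivative X f x * h" for h
    using scale[of h "(1, - pressure X x)"] by (simp add: isentropic_derivative_def mult.commute)
  ultimately show ?thesis
    by (simp add: has_field_derivative_def)
qed

section \<open>Higher derivatives of the energy at constant entropy, and the sound speed\<close>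

text \<open>Points of an isentrope share its entropy, so the derivative found at x is valid at each
  of them. A whole neighbourhood is covered because the identity is differentiated again.\<close>

lemma eventually_deriv_energy:
  assumes "x \<in> dom"
  shows "\<forall>\<^sub>F \<tau> in nhds (fst x). deriv (\<lambda>\<tau>. energy X \<tau> (entropy X x)) \<tau>
    = - pressure X (\<tau>, energy X \<tau> (entropy X x))"
  using eventually_isentrope[OF assms]
proof eventually_elim
  case (elim \<tau>)
  show ?case
    using has_real_derivative_energy[OF energy_chart(1)[OF elim]]
    by (intro DERIV_imp_deriv) (simp add: energy_chart(2)[OF elim])
qed

lemma eventually_deriv2_energy:
  assumes "x \<in> dom"
  shows "\<forall>\<^sub>F \<tau> in nhds (fst x). (deriv ^^ 2) (\<lambda>\<tau>. energy X \<tau> (entropy X x)) \<tau>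
    = stiffness X (\<tau>, energy X \<tau> (entropy X x))"
proof -
  \<comment> \<open>The first derivatives have to agree near each nearby \<tau>, and not just at it,
    before \<open>deriv\<close> can be applied to both sides.\<close>
  have "\<forall>\<^sub>F \<tau> in nhds (fst x). \<forall>\<^sub>F t in nhds \<tau>. deriv (\<lambda>\<tau>. energy X \<tau> (entropy X x)) t
    = - pressure X (t, energy X t (entropy X x))"
    using eventually_deriv_energy[OF assms] by (simp add: eventually_eventually)
  then show ?thesis
    using eventually_isentrope[OF assms]
  proof eventually_elim
    case (elim \<tau>)
    have "(deriv ^^ 2) (\<lambda>\<tau>. energy X \<tau> (entropy X x)) \<tau>
      = deriv (\<lambda>t. - pressure X (t, energy X t (entropy X x))) \<tau>"
      using deriv_cong_ev[OF elim(1) refl] by (simp add: numeral_2_eq_2)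
    also have "\<dots> = stiffness X (\<tau>, energy X \<tau> (entropy X x))"
      using has_real_derivative_isentrope[OF energy_chart(1)[OF elim(2)]
          differentiable_pressure[OF energy_chart(1)[OF elim(2)]]]
      by (intro DERIV_imp_deriv) (auto simp: energy_chart(2)[OF elim(2)] stiffness_def
          intro!: derivative_eq_intros)
    finally show ?case .
  qed
qed

text \<open>Near x the second derivative of the energy along the isentrope is the stiffness q, so
  the third is the isentropic derivative of q.\<close>

lemma fundamental_derivative_eq:
  assumes "x \<in> dom"
  shows "fundamental_derivative X x
    = - (fst x / 2) * (isentropic_derivative X (stiffness X) x / stiffness X x)"
proof -
  have "(deriv ^^ 3) (\<lambda>\<tau>. energy X \<tau> (entropy X x)) (fst x)
      = deriv ((deriv ^^ 2) (\<lambda>\<tau>. energy X \<tau> (entropy X x))) (fst x)"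
    by (simp add: numeral_2_eq_2 numeral_3_eq_3)
  also have "\<dots> = isentropic_derivative X (stiffness X) x"
    using deriv_cong_ev[OF eventually_deriv2_energy[OF assms] refl]
      DERIV_imp_deriv[OF has_real_derivative_isentrope[OF assms differentiable_stiffness[OF assms]]]
    by simp
  finally show ?thesis
    using eventually_nhds_x_imp_x[OF eventually_deriv2_energy[OF assms]]
    by (simp add: fundamental_derivative_def energy_entropy[OF assms])
qed

text \<open>At constant entropy dp/dtau = -q, and dtau/drho = -tau^2, so dp/drho = tau^2 q.\<close>

lemma sound_speed_eq:
  assumes "x \<in> dom"
  shows "sound_speed X x = fst x * sqrt (stiffness X x)"
proof -
  have pos: "fst x > 0" by (rule fst_pos[OF assms])
  have "((\<lambda>\<tau>. pressure X (\<tau>, energy X \<tau> (entropy X x))) has_real_derivative - stiffness X x)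
      (at (1 / (1 / fst x)))"
    using has_real_derivative_isentrope[OF assms differentiable_pressure[OF assms]]
    by (simp add: stiffness_def)
  moreover have "((\<lambda>\<rho>. 1 / \<rho>) has_real_derivative - (fst x)\<^sup>2) (at (1 / fst x))"
    using pos by (auto intro!: derivative_eq_intros simp: power2_eq_square)
  ultimately have "((\<lambda>\<rho>. pressure X (1 / \<rho>, energy X (1 / \<rho>) (entropy X x))) has_real_derivative
      - stiffness X x * - (fst x)\<^sup>2) (at (1 / fst x))"
    by (rule DERIV_chain2)
  then show ?thesis
    using pos by (simp add: sound_speed_def DERIV_imp_deriv real_sqrt_mult)
qed

text \<open>Read off from c > 0 and tau > 0: \<open>sqrt\<close> is positive only at positive
  arguments.\<close>

lemma stiffness_pos: "x \<in> dom \<Longrightarrow> stiffness X x > 0"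
  using sound_speed_pos[of x] fst_pos[of x] by (simp add: sound_speed_eq zero_less_mult_iff)

lemma has_derivative_sound_speed:
  assumes "x \<in> dom"
  shows "(sound_speed X has_derivative
    (\<lambda>h. fst h * sqrt (stiffness X x)
       + fst x * frechet_derivative (stiffness X) (at x) h / (2 * sqrt (stiffness X x)))) (at x)"
proof (rule has_derivative_transform_within_open[OF _ open_dom assms])
  have "(stiffness X has_derivative frechet_derivative (stiffness X) (at x)) (at x)"
    using differentiable_stiffness[OF assms] by (simp add: frechet_derivative_works)
  then show "((\<lambda>x. fst x * sqrt (stiffness X x)) has_derivative
    (\<lambda>h. fst h * sqrt (stiffness X x)
       + fst x * frechet_derivative (stiffness X) (at x) h / (2 * sqrt (stiffness X x)))) (at x)"
    using stiffness_pos[OF assms]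
    by (auto intro!: derivative_eq_intros simp: fun_eq_iff field_simps)
qed (simp add: sound_speed_eq)

end


subsection \<open>Differentials of the state functions\<close>

fun vol_frac_deriv :: "phase \<Rightarrow> state \<Rightarrow> real" where
  "vol_frac_deriv Ph1 h = fst h"
| "vol_frac_deriv Ph2 h = - fst h"

text \<open>Here and below h is a tangent vector in the coordinates of a state. As
  \<open>vel k\<close> and \<open>thermo k\<close> are linear, \<open>vel k h\<close> and
  \<open>thermo k h\<close> are the increments du_k and (dtau_k, de_k).\<close>

definition part_dens_deriv :: "phase \<Rightarrow> state \<Rightarrow> state \<Rightarrow> real" where
  "part_dens_deriv k z h =
     vol_frac_deriv k h / fst (thermo k z) - vol_frac k z * fst (thermo k h) / (fst (thermo k z))\<^sup>2"

definition press_deriv :: "(phase \<Rightarrow> eos) \<Rightarrow> phase \<Rightarrow> state \<Rightarrow> state \<Rightarrow> real" where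
  "press_deriv X k z h = frechet_derivative (pressure (X k)) (at (thermo k z)) (thermo k h)"

definition total_energy_deriv :: "phase \<Rightarrow> state \<Rightarrow> state \<Rightarrow> real" where
  "total_energy_deriv k z h = snd (thermo k h) + vel k z * vel k h"

definition conserved_deriv :: "phase \<Rightarrow> state \<Rightarrow> state \<Rightarrow> real \<times> real \<times> real" where
  "conserved_deriv k z h =
     (part_dens_deriv k z h,
      part_dens_deriv k z h * vel k z + part_dens k z * vel k h,
      part_dens_deriv k z h * total_energy k z + part_dens k z * total_energy_deriv k z h)"

text \<open>The pressure part of the enthalpy is differentiated as p tau instead of p / rho, hence
  dp tau + p dtau.\<close>

definition flux_deriv :: "(phase \<Rightarrow> eos) \<Rightarrow> phase \<Rightarrow> state \<Rightarrow> state \<Rightarrow> real \<times> real \<times> real" where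
  "flux_deriv X k z h =
     (part_dens_deriv k z h * vel k z + part_dens k z * vel k h,
      part_dens_deriv k z h * (vel k z)\<^sup>2 + part_dens k z * (2 * vel k z * vel k h)
        + vol_frac_deriv k h * press X k z + vol_frac k z * press_deriv X k z h,
      (part_dens_deriv k z h * total_enthalpy X k z
        + part_dens k z * (total_energy_deriv k z h + press_deriv X k z h * fst (thermo k z)
            + press X k z * fst (thermo k h))) * vel k z
        + part_dens k z * total_enthalpy X k z * vel k h)"

lemma has_derivative_vol_frac: "(vol_frac k has_derivative vol_frac_deriv k) (at z)"
proof (cases k)
  case Ph1
  have "vol_frac Ph1 = fst" "vol_frac_deriv Ph1 = fst" by auto
  then show ?thesis using Ph1 by (auto intro: bounded_linear_imp_has_derivative bounded_linear_fst)
next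
  case Ph2
  have "vol_frac Ph2 = (\<lambda>z. 1 - fst z)" "vol_frac_deriv Ph2 = (\<lambda>h. - fst h)" by auto
  then show ?thesis using Ph2 by (auto intro!: derivative_eq_intros)
qed

lemma bounded_linear_phase_state: "bounded_linear (phase_state k)"
proof (cases k)
  case Ph1
  have "phase_state Ph1 = (\<lambda>z. fst (snd z))" by auto
  then show ?thesis using Ph1 by (simp add: bounded_linear_fst_comp bounded_linear_snd)
next
  case Ph2
  have "phase_state Ph2 = (\<lambda>z. snd (snd z))" by auto
  then show ?thesis using Ph2 by (simp add: bounded_linear_snd_comp bounded_linear_snd)
qed

lemma bounded_linear_vel: "bounded_linear (vel k)"
  unfolding vel_def[abs_def]
  by (intro bounded_linear_fst_comp bounded_linear_snd_comp bounded_linear_phase_state)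

lemma bounded_linear_thermo: "bounded_linear (thermo k)"
  unfolding thermo_def[abs_def]
  by (intro bounded_linear_Pair bounded_linear_fst_comp bounded_linear_snd_comp bounded_linear_phase_state)

lemmas has_derivative_vel = bounded_linear_imp_has_derivative[OF bounded_linear_vel]
lemmas has_derivative_thermo = bounded_linear_imp_has_derivative[OF bounded_linear_thermo]

lemma phase_state_eq_0_iff: "phase_state k h = 0 \<longleftrightarrow> fst (thermo k h) = 0 \<and> vel k h = 0 \<and> snd (thermo k h) = 0"
  by (auto simp: thermo_def vel_def prod_eq_iff)

lemma state_eq_0_iff: "h = 0 \<longleftrightarrow> fst h = 0 \<and> (\<forall>k. phase_state k h = 0)"
proof -
  have "(\<forall>k. phase_state k h = 0) \<longleftrightarrow> phase_state Ph1 h = 0 \<and> phase_state Ph2 h = 0"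
    using phase.exhaust by metis
  then show ?thesis by (auto simp: prod_eq_iff)
qed

section \<open>Differentials at an admissible state\<close>

locale two_fluid =
  fixes X :: "phase \<Rightarrow> eos"
  assumes complete: "\<And>k. complete_eos (X k)"
begin

sublocale phase: complete_phase "X k" for k
  by unfold_locales (rule complete)

context
  fixes z :: state
  assumes z: "z \<in> admissible X"
begin

lemma thermo_dom: "thermo k z \<in> eos_dom (X k)"
  using z by (simp add: admissible_def)

lemma tau_pos: "fst (thermo k z) > 0"
  using phase.fst_pos[OF thermo_dom] .

lemma vol_frac_pos: "vol_frac k z > 0"
  using z by (cases k) (auto simp: admissible_def)

lemma part_dens_pos: "part_dens k z > 0"
  using tau_pos vol_frac_pos by (simp add: part_dens_def dens_def)

lemma mix_dens_pos: "mix_dens z > 0"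
  using part_dens_pos by (simp add: mix_dens_def add_pos_pos)

lemma has_derivative_part_dens: "(part_dens k has_derivative part_dens_deriv k z) (at z)"
  unfolding part_dens_def[abs_def] dens_def part_dens_deriv_def[abs_def]
  using tau_pos[of k]
  by (auto intro!: derivative_eq_intros has_derivative_vol_frac has_derivative_thermo
      simp: fun_eq_iff power2_eq_square field_simps)

lemma has_derivative_press: "(press X k has_derivative press_deriv X k z) (at z)"
  unfolding press_def[abs_def] press_deriv_def[abs_def]
  using phase.differentiable_pressure[OF thermo_dom]
  by (intro has_derivative_compose[OF has_derivative_thermo]) (simp add: frechet_derivative_works)

lemma has_derivative_total_energy: "(total_energy k has_derivative total_energy_deriv k z) (at z)"
  unfolding total_energy_def[abs_def] total_energy_deriv_def[abs_def]
  by (auto intro!: derivative_eq_intros has_derivative_vel has_derivative_thermo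
      simp: fun_eq_iff)

lemma has_derivative_total_enthalpy:
  "(total_enthalpy X k has_derivative (\<lambda>h. total_energy_deriv k z h
     + press_deriv X k z h * fst (thermo k z) + press X k z * fst (thermo k h))) (at z)"
proof -
  have "total_enthalpy X k = (\<lambda>z. total_energy k z + press X k z * fst (thermo k z))"
    by (simp add: fun_eq_iff total_enthalpy_def dens_def)
  then show ?thesis
    by (auto intro!: derivative_eq_intros has_derivative_total_energy has_derivative_press
        has_derivative_thermo)
qed

lemma has_derivative_conserved:
  "(conserved has_derivative (\<lambda>h. (fst h, conserved_deriv Ph1 z h, conserved_deriv Ph2 z h))) (at z)"
  unfolding conserved_def[abs_def] conserved_deriv_def Let_def
  by (intro has_derivative_Pair)
    (auto intro!: derivative_eq_intros has_derivative_part_dens has_derivative_vel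
      has_derivative_total_energy)

lemma has_derivative_flux:
  "(flux X has_derivative (\<lambda>h. (0, flux_deriv X Ph1 z h, flux_deriv X Ph2 z h))) (at z)"
proof -
  have "((\<lambda>z. (part_dens k z * vel k z,
                    part_dens k z * (vel k z)\<^sup>2 + vol_frac k z * press X k z,
                    part_dens k z * total_enthalpy X k z * vel k z)) has_derivative
    flux_deriv X k z) (at z)" for k
    unfolding flux_deriv_def[abs_def]
    by (intro has_derivative_Pair; rule has_derivative_eq_rhs,
        (rule derivative_intros has_derivative_part_dens has_derivative_vel
      has_derivative_total_enthalpy has_derivative_press has_derivative_vol_frac)+)
     (auto simp: fun_eq_iff algebra_simps)
  then show ?thesis
    unfolding flux_def[abs_def] Let_def by (intro has_derivative_Pair has_derivative_const)
qed

text \<open>The conserved variables are triangular: at constant volume fraction the mass gives dtau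
  = 0, then the momentum gives du = 0, then the energy gives de = 0.\<close>

lemma conserved_deriv_eq_0:
  assumes "conserved_deriv k z h = 0" "vol_frac_deriv k h = 0"
  shows "phase_state k h = 0"
proof -
  have "fst (thermo k h) = 0"
    using assms tau_pos[of k] vol_frac_pos[of k]
    by (simp add: conserved_deriv_def zero_prod_def part_dens_deriv_def)
  with assms part_dens_pos[of k] show ?thesis
    unfolding phase_state_eq_0_iff
    by (auto simp: conserved_deriv_def zero_prod_def total_energy_deriv_def)
qed

text \<open>Injectivity is enough, since \<open>state\<close> and \<open>equations\<close> are the
  same finite-dimensional space.\<close>

lemma bij_frechet_derivative_conserved: "bij (frechet_derivative conserved (at z))"
proof -
  let ?C = "frechet_derivative conserved (at z)"
  have C: "?C = (\<lambda>h. (fst h, conserved_deriv Ph1 z h, conserved_deriv Ph2 z h))"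
    using frechet_derivative_at[OF has_derivative_conserved] by simp
  have lin: "linear ?C"
    using has_derivative_conserved differentiableI linear_frechet_derivative by blast
  have "h = 0" if "?C h = 0" for h
  proof -
    have "fst h = 0" "conserved_deriv Ph1 z h = 0" "conserved_deriv Ph2 z h = 0"
      using that by (auto simp: C zero_prod_def)
    then have "phase_state k h = 0" for k
      by (intro conserved_deriv_eq_0; cases k; simp)
    then show ?thesis using \<open>fst h = 0\<close> by (simp add: state_eq_0_iff)
  qed
  then have "inj ?C"
    using lin by (simp add: linear_injective_0)
  then show ?thesis
    using lin linear_injective_imp_surjective by (auto simp: bij_def)
qed

lemma mix_vel_eq:
  "mix_vel w = (part_dens Ph1 w * vel Ph1 w + part_dens Ph2 w * vel Ph2 w) / mix_dens w"
  by (simp add: mix_vel_def mass_frac_def add_divide_distrib)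

text \<open>The quotient rule for (m_1 u_1 + m_2 u_2) / rho. The numerator is arranged as d(m_1 u_1)
  + d(m_2 u_2) - u drho, which the summed mass balances make vanish when the eigenvalue is
  u.\<close>

lemma has_derivative_mix_vel:
  "(mix_vel has_derivative (\<lambda>h.
     ((part_dens_deriv Ph1 z h * vel Ph1 z + part_dens Ph1 z * vel Ph1 h
       + (part_dens_deriv Ph2 z h * vel Ph2 z + part_dens Ph2 z * vel Ph2 h))
      - mix_vel z * (part_dens_deriv Ph1 z h + part_dens_deriv Ph2 z h)) / mix_dens z)) (at z)"
proof -
  have "(mix_dens has_derivative (\<lambda>h. part_dens_deriv Ph1 z h + part_dens_deriv Ph2 z h)) (at z)"
    unfolding mix_dens_def[abs_def] by (intro has_derivative_add has_derivative_part_dens)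
  moreover have eq: "mix_vel = (\<lambda>w. (part_dens Ph1 w * vel Ph1 w + part_dens Ph2 w * vel Ph2 w) / mix_dens w)"
    by (simp add: fun_eq_iff mix_vel_eq)
  ultimately show ?thesis
    using mix_dens_pos unfolding eq
    by (auto intro!: derivative_eq_intros has_derivative_part_dens has_derivative_vel
        simp: fun_eq_iff field_simps)
qed

lemma has_derivative_sound:
  "(sound X k has_derivative (\<lambda>h. fst (thermo k h) * sqrt (stiffness (X k) (thermo k z))
     + fst (thermo k z) * frechet_derivative (stiffness (X k)) (at (thermo k z)) (thermo k h)
       / (2 * sqrt (stiffness (X k) (thermo k z))))) (at z)"
  unfolding sound_def[abs_def]
  by (rule has_derivative_compose[OF has_derivative_thermo phase.has_derivative_sound_speed[OF thermo_dom]])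

lemma differentiable_eigenvalue: "eigenvalue X w differentiable (at z)"
proof -
  note d = differentiableI[OF has_derivative_mix_vel] differentiableI[OF has_derivative_vel]
    differentiableI[OF has_derivative_sound]
  show ?thesis
    by (cases w; simp add: eigenvalue.simps[abs_def]) (intro derivative_intros d)+
qed

end

end


subsection \<open>The eigenvector equations\<close>

lemma linear_inv_bij:
  assumes "linear f" "bij f"
  shows "linear (inv f)"
proof (rule linearI)
  interpret linear f by fact
  have inj: "inj f" and f: "f (inv f y) = y" for y
    using assms(2) by (auto simp: bij_is_inj bij_is_surj surj_f_inv_f)
  show "inv f (x + y) = inv f x + inv f y" for x y
    by (rule inv_f_eq[OF inj]) (simp add: add f)
  show "inv f (c *\<^sub>R x) = c *\<^sub>R inv f x" for c x
    by (rule inv_f_eq[OF inj]) (simp add: scale f)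
qed

text \<open>Pure algebra for one phase: \<open>dm\<close> is the increment of \<alpha> / \<tau> at
  constant \<alpha>. The conclusions are the linearised Euler equations in primitive form; the last
  one says (u - \<mu>) T ds = 0.\<close>

lemma euler_eigenvector:
  fixes \<alpha> \<tau> u E p \<mu> m dm d\<tau> du de dp :: real
  defines "m \<equiv> \<alpha> / \<tau>" and "dm \<equiv> - (\<alpha> * d\<tau> / \<tau>\<^sup>2)"
  assumes pos: "\<alpha> > 0" "\<tau> > 0"
    and mass: "\<mu> * dm = dm * u + m * du"
    and momentum: "\<mu> * (dm * u + m * du) = dm * u\<^sup>2 + m * (2 * u * du) + \<alpha> * dp"
    and energy: "\<mu> * (dm * E + m * (de + u * du))
      = (dm * (E + p * \<tau>) + m * (de + u * du + dp * \<tau> + p * d\<tau>)) * u + m * (E + p * \<tau>) * du"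
  shows "(u - \<mu>) * d\<tau> = \<tau> * du" "(u - \<mu>) * du = - \<tau> * dp" "(u - \<mu>) * (de + p * d\<tau>) = 0"
proof -
  have m: "m \<noteq> 0" "m * \<tau> = \<alpha>" and dm: "dm * \<tau> = - m * d\<tau>"
    using pos by (auto simp: m_def dm_def field_simps power2_eq_square)
  have "m * ((u - \<mu>) * d\<tau> - \<tau> * du) = 0"
    using mass dm by algebra
  then show 1: "(u - \<mu>) * d\<tau> = \<tau> * du"
    using m by simp
  \<comment> \<open>Momentum minus u times mass.\<close>
  have "m * ((u - \<mu>) * du + \<tau> * dp) = 0"
    using mass momentum m by algebra
  then show 2: "(u - \<mu>) * du = - \<tau> * dp"
    using m by simp
  \<comment> \<open>Energy minus E times mass, reduced by the two relations just found.\<close>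
  have "m * ((u - \<mu>) * (de + p * d\<tau>)) = 0"
    using mass energy m dm 1 2 by algebra
  then show "(u - \<mu>) * (de + p * d\<tau>) = 0"
    using m by simp
qed

context two_fluid
begin

section \<open>The eigenvector equations in arbitrary state variables\<close>

context
  fixes \<Phi> :: "real^7 \<Rightarrow> state" and D :: "(real^7) set"
  assumes vars: "state_variables X \<Phi> D"
begin

abbreviation tangent :: "real^7 \<Rightarrow> real^7 \<Rightarrow> state" where
  "tangent U \<equiv> frechet_derivative \<Phi> (at U)"

lemma open_D: "open D" and admissible_\<Phi>: "U \<in> D \<Longrightarrow> \<Phi> U \<in> admissible X"
  and smooth_\<Phi>: "smooth_on D \<Phi>" and bij_tangent: "U \<in> D \<Longrightarrow> bij (tangent U)"
  using vars by (auto simp: state_variables_def)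

lemma has_derivative_\<Phi>: "U \<in> D \<Longrightarrow> (\<Phi> has_derivative tangent U) (at U)"
  using smooth_on_differentiable[OF smooth_\<Phi>] by (simp add: frechet_derivative_works)

lemma linear_tangent: "U \<in> D \<Longrightarrow> linear (tangent U)"
  using has_derivative_\<Phi> has_derivative_linear by blast

lemma frechet_derivative_comp_\<Phi>:
  assumes "U \<in> D" "(f has_derivative f') (at (\<Phi> U))"
  shows "frechet_derivative (f \<circ> \<Phi>) (at U) V = f' (tangent U V)"
    and "(f \<circ> \<Phi>) differentiable (at U)"
  using diff_chain_at[OF has_derivative_\<Phi>[OF assms(1)] assms(2)]
  by (auto simp flip: frechet_derivative_at intro: differentiableI)

text \<open>Applying DW to M V = \<mu> V removes the inverse in \<open>quasilinear_matrix\<close>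
  and leaves \<mu> dW = dF + B dalpha_1 for the increment h, which is then read row by row.\<close>

lemma quasilinear_eigenvector:
  assumes U: "U \<in> D" and eig: "quasilinear_matrix X \<Phi> U *v V = \<mu> *\<^sub>R V"
  defines "z \<equiv> \<Phi> U" and "h \<equiv> tangent U V"
  shows "\<mu> * fst h = mix_vel z * fst h"
    and "\<mu> *\<^sub>R conserved_deriv k z h = flux_deriv X k z h
      + vol_frac_deriv k h *\<^sub>R (0, - interf_press X z, - interf_work X z)"
proof -
  note z = admissible_\<Phi>[OF U]
  let ?C = "frechet_derivative conserved (at (\<Phi> U))"
  let ?W = "frechet_derivative (conserved \<circ> \<Phi>) (at U)"
  let ?R = "\<lambda>V. frechet_derivative (flux X \<circ> \<Phi>) (at U) V
        + frechet_derivative (vol_frac Ph1 \<circ> \<Phi>) (at U) V *\<^sub>R nonconservative X (\<Phi> U)"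
  have C: "?C = (\<lambda>h. (fst h, conserved_deriv Ph1 z h, conserved_deriv Ph2 z h))"
    unfolding z_def by (rule frechet_derivative_at[OF has_derivative_conserved[OF z], symmetric])
  have W: "?W = ?C \<circ> tangent U"
    using frechet_derivative_comp_\<Phi>(1)[OF U has_derivative_conserved[OF z]]
    by (auto simp: fun_eq_iff C z_def)
  have "bij ?W"
    unfolding W by (rule bij_comp[OF bij_tangent[OF U] bij_frechet_derivative_conserved[OF z]])
  have linW: "linear ?W"
    by (rule linear_frechet_derivative[OF frechet_derivative_comp_\<Phi>(2)[OF U has_derivative_conserved[OF z]]])
  have "linear (\<lambda>V. frechet_derivative (vol_frac Ph1 \<circ> \<Phi>) (at U) V *\<^sub>R nonconservative X (\<Phi> U))"
    by (rule linear_compose[OF linear_frechet_derivative[OF frechet_derivative_comp_\<Phi>(2)[OF U has_derivative_vol_frac]]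
        bounded_linear.linear[OF bounded_linear_scaleR_left], unfolded comp_def[of "\<lambda>r. r *\<^sub>R _"]])
  then have "linear ?R"
    by (rule linear_compose_add[OF linear_frechet_derivative[OF
        frechet_derivative_comp_\<Phi>(2)[OF U has_derivative_flux[OF z]]]])
  then have "linear (inv ?W \<circ> ?R)"
    by (rule linear_compose[OF _ linear_inv_bij[OF linW \<open>bij ?W\<close>]])
  \<comment> \<open>\<open>matrix\<close> represents a map faithfully only if the map is linear,
    hence the preceding collection of linearity facts.\<close>
  then have "matrix (inv ?W \<circ> ?R) *v V = (inv ?W \<circ> ?R) V"
    by (rule fun_cong[OF matrix_vector_mul(2)])
  then have "quasilinear_matrix X \<Phi> U *v V = inv ?W (?R V)"
    by (simp only: quasilinear_matrix_def comp_def[of "inv _"])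
  then have "?W (\<mu> *\<^sub>R V) = ?R V"
    unfolding eig using \<open>bij ?W\<close> by (metis bij_is_surj surj_f_inv_f)
  then have "\<mu> *\<^sub>R ?W V = ?R V"
    by (simp only: linear_scale[OF linW])
  then have "\<mu> *\<^sub>R ?C h = ?R V"
    by (simp only: W comp_apply h_def)
  then have eq: "\<mu> *\<^sub>R (fst h, conserved_deriv Ph1 z h, conserved_deriv Ph2 z h)
    = (0, flux_deriv X Ph1 z h, flux_deriv X Ph2 z h) + fst h *\<^sub>R nonconservative X z"
    unfolding C frechet_derivative_comp_\<Phi>(1)[OF U has_derivative_flux[OF z]]
      frechet_derivative_comp_\<Phi>(1)[OF U has_derivative_vol_frac]
    by (simp add: h_def z_def)
  then show "\<mu> * fst h = mix_vel z * fst h"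
    by (simp add: nonconservative_def)
  show "\<mu> *\<^sub>R conserved_deriv k z h = flux_deriv X k z h
      + vol_frac_deriv k h *\<^sub>R (0, - interf_press X z, - interf_work X z)"
    using eq by (cases k) (simp_all add: nonconservative_def)
qed

lemma mass_balance:
  assumes "U \<in> D" "quasilinear_matrix X \<Phi> U *v V = \<mu> *\<^sub>R V"
  shows "\<mu> * part_dens_deriv k (\<Phi> U) (tangent U V)
    = part_dens_deriv k (\<Phi> U) (tangent U V) * vel k (\<Phi> U) + part_dens k (\<Phi> U) * vel k (tangent U V)"
  using quasilinear_eigenvector(2)[OF assms, of k]
  by (auto simp: conserved_deriv_def flux_deriv_def prod_eq_iff)

text \<open>With dalpha_1 = 0 the interfacial terms drop out and the phases decouple. As \<mu>
  differs from u_k the increment is isentropic, and then (u_k - \<mu>)^2 dtau = (u_k - \<mu>) tau du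
  = -tau^2 dp = c_k^2 dtau.\<close>

lemma phase_eigenvector:
  assumes U: "U \<in> D" and eig: "quasilinear_matrix X \<Phi> U *v V = \<mu> *\<^sub>R V"
    and "fst (tangent U V) = 0"
  defines "z \<equiv> \<Phi> U" and "h \<equiv> tangent U V"
  assumes ne: "\<mu> \<noteq> vel k z"
  shows "(vel k z - \<mu>) * fst (thermo k h) = fst (thermo k z) * vel k h"
    and "snd (thermo k h) = - press X k z * fst (thermo k h)"
    and "((vel k z - \<mu>)\<^sup>2 - (sound X k z)\<^sup>2) * fst (thermo k h) = 0"
proof -
  have z: "z \<in> admissible X" using admissible_\<Phi>[OF U] by (simp add: z_def)
  have v: "vol_frac_deriv k h = 0" using assms(3) by (cases k) (auto simp: h_def)
  have m: "part_dens k z = vol_frac k z / fst (thermo k z)"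
    by (simp add: part_dens_def dens_def)
  have H: "total_enthalpy X k z = total_energy k z + press X k z * fst (thermo k z)"
    by (simp add: total_enthalpy_def dens_def)
  have dm: "part_dens_deriv k z h = - (vol_frac k z * fst (thermo k h) / (fst (thermo k z))\<^sup>2)"
    by (simp add: part_dens_deriv_def v)
  have eq: "\<mu> *\<^sub>R conserved_deriv k z h = flux_deriv X k z h"
    using quasilinear_eigenvector(2)[OF U eig, of k] v
    by (simp only: z_def h_def scaleR_zero_left add_0_right)
  note euler = euler_eigenvector[OF vol_frac_pos[OF z, of k] tau_pos[OF z, of k],
      of \<mu> "fst (thermo k h)" "vel k z" "vel k h" "press_deriv X k z h" "total_energy k z"
         "snd (thermo k h)" "press X k z", folded dm m]
  have e: "(vel k z - \<mu>) * fst (thermo k h) = fst (thermo k z) * vel k h"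
     "(vel k z - \<mu>) * vel k h = - fst (thermo k z) * press_deriv X k z h"
     "(vel k z - \<mu>) * (snd (thermo k h) + press X k z * fst (thermo k h)) = 0"
    using eq v by (intro euler; simp add: conserved_deriv_def flux_deriv_def total_energy_deriv_def H)+
  show "(vel k z - \<mu>) * fst (thermo k h) = fst (thermo k z) * vel k h" by (rule e(1))
  show iso: "snd (thermo k h) = - press X k z * fst (thermo k h)"
    using e(3) ne by (simp add: eq_neg_iff_add_eq_0)
  \<comment> \<open>The increment (dtau, de) is a multiple of the isentropic direction (1, -p), so
    dp = -q dtau.\<close>
  have "press_deriv X k z h = - stiffness (X k) (thermo k z) * fst (thermo k h)"
  proof -
    interpret linear "frechet_derivative (pressure (X k)) (at (thermo k z))"
      by (rule linear_frechet_derivative[OF phase.differentiable_pressure[OF thermo_dom[OF z]]])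
    have "thermo k h = fst (thermo k h) *\<^sub>R (1, - pressure (X k) (thermo k z))"
      using iso by (simp add: prod_eq_iff press_def)
    then show ?thesis
      using scale[of "fst (thermo k h)" "(1, - pressure (X k) (thermo k z))"]
      by (simp add: press_deriv_def stiffness_def isentropic_derivative_def)
  qed
  moreover have "(sound X k z)\<^sup>2 = (fst (thermo k z))\<^sup>2 * stiffness (X k) (thermo k z)"
    using phase.stiffness_pos[OF thermo_dom[OF z], of k]
    by (simp add: sound_def phase.sound_speed_eq[OF thermo_dom[OF z]] power_mult_distrib)
  ultimately show "((vel k z - \<mu>)\<^sup>2 - (sound X k z)\<^sup>2) * fst (thermo k h) = 0"
    using e(1,2) by algebra
qed

section \<open>Linear degeneracy of the convective fields\<close>

lemma linearly_degenerate_mixture: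
  assumes U: "U \<in> D" and eig: "quasilinear_matrix X \<Phi> U *v V = mix_vel (\<Phi> U) *\<^sub>R V"
  shows "frechet_derivative (eigenvalue X Mixture \<circ> \<Phi>) (at U) V = 0"
proof -
  have "eigenvalue X Mixture = mix_vel" by auto
  then show ?thesis
    using frechet_derivative_comp_\<Phi>(1)[OF U has_derivative_mix_vel[OF admissible_\<Phi>[OF U]], of V]
      mass_balance[OF U eig, of Ph1] mass_balance[OF U eig, of Ph2]
    by (simp add: algebra_simps)
qed

lemma linearly_degenerate_convective:
  assumes U: "U \<in> D" and eig: "quasilinear_matrix X \<Phi> U *v V = vel k (\<Phi> U) *\<^sub>R V"
  shows "frechet_derivative (eigenvalue X (Convective k) \<circ> \<Phi>) (at U) V = 0"
proof -
  have "eigenvalue X (Convective k) = vel k" by auto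
  then show ?thesis
    using frechet_derivative_comp_\<Phi>(1)[OF U has_derivative_vel, of k V]
      mass_balance[OF U eig, of k] part_dens_pos[OF admissible_\<Phi>[OF U], of k]
    by simp
qed

section \<open>Variation of an acoustic eigenvalue along its eigenvector\<close>

text \<open>The factor \<open>\<sigma>\<close> treats both acoustic waves at once. The hypothesis
  that the component of phase k is nonzero is later obtained through
  \<open>acoustic_other_phase\<close>.\<close>

lemma acoustic_derivative:
  assumes U: "U \<in> D" and eig: "quasilinear_matrix X \<Phi> U *v V = (vel k (\<Phi> U) + \<sigma> * sound X k (\<Phi> U)) *\<^sub>R V"
    and \<sigma>: "\<sigma> \<noteq> 0" and "fst (tangent U V) = 0"
    and G: "fundamental_derivative (X k) (thermo k (\<Phi> U)) \<noteq> 0"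
    and nz: "phase_state k (tangent U V) \<noteq> 0"
  shows "frechet_derivative ((\<lambda>z. vel k z + \<sigma> * sound X k z) \<circ> \<Phi>) (at U) V \<noteq> 0"
proof -
  define z where "z = \<Phi> U"
  define h where "h = tangent U V"
  let ?x = "thermo k z"
  have z: "z \<in> admissible X" using admissible_\<Phi>[OF U] by (simp add: z_def)
  note dom = thermo_dom[OF z, of k]
  have q: "stiffness (X k) ?x > 0" by (rule phase.stiffness_pos[OF dom])
  have \<tau>: "fst ?x > 0" by (rule tau_pos[OF z])
  have c: "sound X k z = fst ?x * sqrt (stiffness (X k) ?x)"
    by (simp add: sound_def phase.sound_speed_eq[OF dom])
  then have ne: "vel k z + \<sigma> * sound X k z \<noteq> vel k z"
    using q \<tau> \<sigma> by simp
  note e = phase_eigenvector[OF U eig assms(4), of k, folded z_def h_def, OF ne]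
  have du: "vel k h = - \<sigma> * sqrt (stiffness (X k) ?x) * fst (thermo k h)"
  proof -
    have "fst ?x * (vel k h + \<sigma> * sqrt (stiffness (X k) ?x) * fst (thermo k h)) = 0"
      using e(1) by (simp add: c algebra_simps)
    then show ?thesis using \<tau> by simp
  qed
  \<comment> \<open>If dtau were 0, then de and du would vanish too, and with them the component of
    phase k.\<close>
  have d\<tau>: "fst (thermo k h) \<noteq> 0"
    using nz e(2) du unfolding phase_state_eq_0_iff h_def by auto
  interpret linear "frechet_derivative (stiffness (X k)) (at ?x)"
    by (rule linear_frechet_derivative[OF phase.differentiable_stiffness[OF dom]])
  have "thermo k h = fst (thermo k h) *\<^sub>R (1, - pressure (X k) ?x)"
    using e(2) by (simp add: prod_eq_iff press_def)
  then have dq: "frechet_derivative (stiffness (X k)) (at ?x) (thermo k h)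
      = fst (thermo k h) * isentropic_derivative (X k) (stiffness (X k)) ?x"
    using scale[of "fst (thermo k h)" "(1, - pressure (X k) ?x)"]
    by (simp add: isentropic_derivative_def)
  have "frechet_derivative ((\<lambda>z. vel k z + \<sigma> * sound X k z) \<circ> \<Phi>) (at U) V
    = vel k h + \<sigma> * (fst (thermo k h) * sqrt (stiffness (X k) ?x)
       + fst ?x * frechet_derivative (stiffness (X k)) (at ?x) (thermo k h)
         / (2 * sqrt (stiffness (X k) ?x)))"
    unfolding z_def h_def
    by (rule frechet_derivative_comp_\<Phi>(1)[OF U])
      (intro has_derivative_add has_derivative_vel has_derivative_mult_right
        has_derivative_sound admissible_\<Phi> U)
  \<comment> \<open>Differentiating the factor tau of c = tau sqrt q gives \<sigma> sqrt q dtau,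
    which cancels du; only the variation of q remains.\<close>
  also have "\<dots> = \<sigma> * fst ?x * fst (thermo k h) * isentropic_derivative (X k) (stiffness (X k)) ?x
      / (2 * sqrt (stiffness (X k) ?x))"
    by (simp add: du dq algebra_simps)
  also have "\<dots> \<noteq> 0"
    using G phase.fundamental_derivative_eq[OF dom] d\<tau> \<tau> q \<sigma> by (auto simp: z_def)
  finally show ?thesis .
qed


section \<open>Coincidences between eigenvalues of the two phases\<close>

text \<open>Finitely many continuous functions, one for each acoustic wave, are required to be
  nonzero. Openness allows a point to be perturbed without meeting resonance.\<close>

lemma open_out_of_resonance: "open {U \<in> D. out_of_resonance X (\<Phi> U)}"
proof -
  define W where "W = {Acoustic_minus Ph1, Acoustic_minus Ph2, Acoustic_plus Ph1, Acoustic_plus Ph2}"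
  let ?f = "\<lambda>w U. eigenvalue X Mixture (\<Phi> U) - eigenvalue X w (\<Phi> U)"
  have "continuous_on D (?f w)" for w
  proof (rule continuous_at_imp_continuous_on, rule ballI)
    fix U assume U: "U \<in> D"
    have "(\<lambda>U. eigenvalue X w (\<Phi> U)) differentiable (at U)" for w
      using differentiable_chain_at[OF differentiableI[OF has_derivative_\<Phi>[OF U]]
          differentiable_eigenvalue[OF admissible_\<Phi>[OF U]]]
      by (simp add: o_def)
    then show "isCont (?f w) U"
      by (intro differentiable_imp_continuous_within differentiable_diff)
  qed
  then have "open (D \<inter> ?f w -` (- {0}))" for w
    using open_D by (intro continuous_open_preimage) auto
  then have "open (\<Inter>w\<in>W. D \<inter> ?f w -` (- {0}))"
    by (intro open_INT) (auto simp: W_def)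
  moreover have "out_of_resonance X z \<longleftrightarrow> (\<forall>w\<in>W. eigenvalue X Mixture z \<noteq> eigenvalue X w z)" for z
  proof -
    have "(\<forall>k. P k) \<longleftrightarrow> P Ph1 \<and> P Ph2" for P
      using phase.exhaust by metis
    then show ?thesis by (auto simp: out_of_resonance_def W_def)
  qed
  then have "{U \<in> D. out_of_resonance X (\<Phi> U)} = (\<Inter>w\<in>W. D \<inter> ?f w -` (- {0}))"
    by (auto simp: W_def)
  ultimately show ?thesis by simp
qed

text \<open>Moving \<open>u\<^sub>k\<close> alone shifts the acoustic eigenvalue of phase \<open>k\<close> and keeps all eigenvalues of
  the other phase, so coincidences between the two phases are nowhere dense.\<close>

lemma eventually_no_coincidence:
  assumes U: "U \<in> D" and "j \<noteq> k"
  shows "\<exists>v. \<forall>\<sigma> \<kappa>. \<forall>\<^sub>F t in at 0.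
    vel k (\<Phi> (U + t *\<^sub>R v)) + \<sigma> * sound X k (\<Phi> (U + t *\<^sub>R v))
      \<noteq> vel j (\<Phi> (U + t *\<^sub>R v)) + \<kappa> * sound X j (\<Phi> (U + t *\<^sub>R v))"
proof -
  define h :: state where "h = (case k of Ph1 \<Rightarrow> (0, (0, 1, 0), 0) | Ph2 \<Rightarrow> (0, 0, (0, 1, 0)))"
  have h: "vel k h = 1" "thermo k h = 0" "vel j h = 0" "thermo j h = 0"
    using \<open>j \<noteq> k\<close> by (cases j; cases k; simp add: h_def vel_def thermo_def zero_prod_def)+
  obtain v where v: "tangent U v = h"
    using surjD[OF bij_is_surj[OF bij_tangent[OF U]], of h] by auto
  note z = admissible_\<Phi>[OF U]
  have sound_diff: "(sound X i has_derivative frechet_derivative (sound X i) (at (\<Phi> U))) (at (\<Phi> U))" for i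
    using differentiableI[OF has_derivative_sound[OF z]] by (simp add: frechet_derivative_works)
  \<comment> \<open>The sound speed depends on the thermodynamic state only, so to first order a
    change of velocity leaves it fixed.\<close>
  have sound_h: "frechet_derivative (sound X i) (at (\<Phi> U)) h = 0" if "thermo i h = 0" for i
  proof -
    have "linear (frechet_derivative (stiffness (X i)) (at (thermo i (\<Phi> U))))"
      by (rule linear_frechet_derivative[OF phase.differentiable_stiffness[OF thermo_dom[OF z]]])
    then show ?thesis
      using that by (simp add: linear_0 flip: frechet_derivative_at[OF has_derivative_sound[OF z]])
  qed
  have "\<forall>\<^sub>F t in at 0.
    vel k (\<Phi> (U + t *\<^sub>R v)) + \<sigma> * sound X k (\<Phi> (U + t *\<^sub>R v))
      \<noteq> vel j (\<Phi> (U + t *\<^sub>R v)) + \<kappa> * sound X j (\<Phi> (U + t *\<^sub>R v))" for \<sigma> \<kappa>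
  proof -
    let ?f = "\<lambda>z. (vel k z + \<sigma> * sound X k z) - (vel j z + \<kappa> * sound X j z)"
    let ?f' = "\<lambda>h. (vel k h + \<sigma> * frechet_derivative (sound X k) (at (\<Phi> U)) h)
      - (vel j h + \<kappa> * frechet_derivative (sound X j) (at (\<Phi> U)) h)"
    let ?g = "\<lambda>t. ?f (\<Phi> (U + t *\<^sub>R v))"
    have f: "(?f has_derivative ?f') (at (\<Phi> U))"
      by (intro has_derivative_diff has_derivative_add has_derivative_mult_right has_derivative_vel
          sound_diff)
    then have lin: "linear ?f'"
      by (rule has_derivative_linear)
    have "((\<lambda>t. U + t *\<^sub>R v) has_derivative (\<lambda>t. t *\<^sub>R v)) (at 0)"
      by (auto intro!: derivative_eq_intros)
    then have "((\<lambda>t. \<Phi> (U + t *\<^sub>R v)) has_derivative (\<lambda>t. tangent U (t *\<^sub>R v))) (at 0)"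
      by (rule has_derivative_compose) (simp add: has_derivative_\<Phi>[OF U])
    then have "(?g has_derivative (\<lambda>t. ?f' (tangent U (t *\<^sub>R v)))) (at 0)"
      by (rule has_derivative_compose) (simp add: f)
    \<comment> \<open>The slope is 1 whatever \<sigma> and \<kappa> are, so a single direction v
      serves all pairs.\<close>
    moreover have "(\<lambda>t. ?f' (tangent U (t *\<^sub>R v))) = (*) 1"
    proof
      show "?f' (tangent U (t *\<^sub>R v)) = 1 * t" for t
        using linear_scale[OF lin, of t h] h sound_h
        by (simp add: linear_scale[OF linear_tangent[OF U]] v)
    qed
    ultimately have g: "(?g has_real_derivative 1) (at 0)"
      by (simp only: has_field_derivative_def)
    \<comment> \<open>A coincidence at t = 0 is broken by the nonzero slope; otherwise continuity
      keeps the difference nonzero.\<close>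
    have "\<forall>\<^sub>F t in at 0. ?g t \<noteq> 0"
    proof (cases "?g 0 = 0")
      case True
      have "((\<lambda>t. (?g t - ?g 0) / (t - 0)) \<longlongrightarrow> 1) (at 0)"
        using g by (simp only: has_field_derivative_iff)
      then have "\<forall>\<^sub>F t in at 0. (?g t - ?g 0) / (t - 0) \<noteq> 0"
        by (rule tendsto_imp_eventually_ne) simp
      then show ?thesis by eventually_elim (use True in auto)
    next
      case False
      then show ?thesis
        using DERIV_isCont[OF g] unfolding isCont_def by (intro tendsto_imp_eventually_ne)
    qed
    then show ?thesis by eventually_elim simp
  qed
  then show ?thesis by blast
qed

text \<open>Smoothness of \<Phi> gives continuity of its differential in each fixed direction;
  expanding r in the standard basis transfers this to a moving direction.\<close>

lemma continuous_on_tangent: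
  assumes "G \<subseteq> D" "continuous_on G r"
  shows "continuous_on G (\<lambda>U. tangent U (r U))"
proof -
  have "continuous_on G (\<lambda>U. \<Sum>i\<in>UNIV. r U $ i *\<^sub>R tangent U (axis i 1))"
  proof (intro continuous_intros assms)
    show "continuous_on G (\<lambda>U. tangent U (axis i 1))" for i
      using smooth_on_imp_continuous_on[OF smooth_on_frechet_derivative[OF smooth_\<Phi>]] assms(1)
      by (rule continuous_on_subset)
  qed
  moreover have "tangent U (r U) = (\<Sum>i\<in>UNIV. r U $ i *\<^sub>R tangent U (axis i 1))" if "U \<in> G" for U
  proof -
    interpret linear "tangent U" using linear_tangent that assms(1) by blast
    show ?thesis
      by (subst basis_expansion[of "r U", symmetric, unfolded scalar_mult_eq_scaleR])
        (simp only: sum scale)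
  qed
  ultimately show ?thesis
    by (simp cong: continuous_on_cong)
qed

text \<open>Where the acoustic eigenvalue of phase \<open>k\<close> is an eigenvalue of the other phase too, the
  eigenvector equations alone do not determine the component of the other phase; it vanishes as a limit
  of points without such a coincidence.\<close>

lemma acoustic_other_phase:
  assumes G: "G = {U \<in> D. out_of_resonance X (\<Phi> U)}" and cont: "continuous_on G r"
    and eig: "\<And>U. U \<in> G \<Longrightarrow> quasilinear_matrix X \<Phi> U *v r U
      = (vel k (\<Phi> U) + \<sigma> * sound X k (\<Phi> U)) *\<^sub>R r U"
    and \<alpha>: "\<And>U. U \<in> G \<Longrightarrow> fst (tangent U (r U)) = 0"
    and "j \<noteq> k" and U: "U \<in> G"
  shows "phase_state j (tangent U (r U)) = 0"
proof -
  let ?\<mu> = "\<lambda>U. vel k (\<Phi> U) + \<sigma> * sound X k (\<Phi> U)"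
  have GD: "G \<subseteq> D" using G by auto
  \<comment> \<open>The coefficients 0, 1, -1 stand for the eigenvalues u_j, u_j + c_j, u_j - c_j of
    the other phase. Away from all three the quadratic relation forces dtau_j = 0, and then du_j =
    de_j = 0.\<close>
  have zero: "phase_state j (tangent V (r V)) = 0"
    if V: "V \<in> G" and ne: "?\<mu> V \<noteq> vel j (\<Phi> V) + 0 * sound X j (\<Phi> V)"
      "?\<mu> V \<noteq> vel j (\<Phi> V) + 1 * sound X j (\<Phi> V)" "?\<mu> V \<noteq> vel j (\<Phi> V) + -1 * sound X j (\<Phi> V)" for V
  proof -
    have VD: "V \<in> D" using V GD by auto
    note e = phase_eigenvector[OF VD eig[OF V] \<alpha>[OF V], of j]
    have "vel j (\<Phi> V) - ?\<mu> V \<noteq> sound X j (\<Phi> V)" "vel j (\<Phi> V) - ?\<mu> V \<noteq> - sound X j (\<Phi> V)"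
      using ne by linarith+
    then have "(vel j (\<Phi> V) - ?\<mu> V)\<^sup>2 - (sound X j (\<Phi> V))\<^sup>2 \<noteq> 0"
      by (simp only: power2_eq_iff right_minus_eq) blast
    then have d\<tau>: "fst (thermo j (tangent V (r V))) = 0"
      using e(3) ne(1) by auto
    then show ?thesis
      using e(1,2) ne(1) tau_pos[OF admissible_\<Phi>[OF VD], of j] unfolding phase_state_eq_0_iff by auto
  qed
  have UD: "U \<in> D" using U GD by auto
  obtain v where v: "\<And>\<sigma> \<kappa>. \<forall>\<^sub>F t in at 0.
    vel k (\<Phi> (U + t *\<^sub>R v)) + \<sigma> * sound X k (\<Phi> (U + t *\<^sub>R v))
      \<noteq> vel j (\<Phi> (U + t *\<^sub>R v)) + \<kappa> * sound X j (\<Phi> (U + t *\<^sub>R v))"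
    using eventually_no_coincidence[OF UD \<open>j \<noteq> k\<close>] by blast
  have "((\<lambda>t. U + t *\<^sub>R v) \<longlongrightarrow> U + 0 *\<^sub>R v) (at 0)"
    by (intro tendsto_intros)
  then have lim: "((\<lambda>t. U + t *\<^sub>R v) \<longlongrightarrow> U) (at 0)" by simp
  \<comment> \<open>The resonance-free set is open, so the perturbed points stay in G for small
    t.\<close>
  have "\<forall>\<^sub>F t in at 0. U + t *\<^sub>R v \<in> G"
    using topological_tendstoD[OF lim] open_out_of_resonance U unfolding G by blast
  then have "\<forall>\<^sub>F t in at 0. phase_state j (tangent (U + t *\<^sub>R v) (r (U + t *\<^sub>R v))) = 0"
    using v[of \<sigma> 0] v[of \<sigma> 1] v[of \<sigma> "-1"] by eventually_elim (rule zero)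
  then have "((\<lambda>t. phase_state j (tangent (U + t *\<^sub>R v) (r (U + t *\<^sub>R v)))) \<longlongrightarrow> 0) (at 0)"
    by (rule tendsto_eventually)
  moreover have "((\<lambda>t. phase_state j (tangent (U + t *\<^sub>R v) (r (U + t *\<^sub>R v))))
      \<longlongrightarrow> phase_state j (tangent U (r U))) (at 0)"
  proof (rule bounded_linear.tendsto[OF bounded_linear_phase_state])
    have "isCont (\<lambda>U. tangent U (r U)) U"
      using continuous_on_tangent[OF GD cont] U open_out_of_resonance continuous_on_eq_continuous_at
      unfolding G by blast
    then show "((\<lambda>t. tangent (U + t *\<^sub>R v) (r (U + t *\<^sub>R v))) \<longlongrightarrow> tangent U (r U)) (at 0)"
      using lim by (rule isCont_tendsto_compose)
  qed
  ultimately show ?thesis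
    using tendsto_unique[of "at (0::real)"] by fastforce
qed

section \<open>Genuine nonlinearity of the acoustic fields\<close>

text \<open>Since the differential of \<Phi> is invertible, the increment is nonzero. Absence of
  resonance removes its volume-fraction component and \<open>acoustic_other_phase\<close> that of
  the other phase, so phase k carries it. The field is given on all of G because the limit argument
  visits neighbouring points.\<close>

lemma genuinely_nonlinear_acoustic:
  assumes G: "G = {U \<in> D. out_of_resonance X (\<Phi> U)}" and cont: "continuous_on G r"
    and eig: "\<And>U. U \<in> G \<Longrightarrow> quasilinear_matrix X \<Phi> U *v r U
      = (vel k (\<Phi> U) + \<sigma> * sound X k (\<Phi> U)) *\<^sub>R r U"
    and nz: "\<And>U. U \<in> G \<Longrightarrow> r U \<noteq> 0"
    and \<sigma>: "\<sigma> = 1 \<or> \<sigma> = -1"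
    and fund: "\<And>x. x \<in> eos_dom (X k) \<Longrightarrow> fundamental_derivative (X k) x \<noteq> 0"
    and U: "U \<in> G"
  shows "frechet_derivative ((\<lambda>z. vel k z + \<sigma> * sound X k z) \<circ> \<Phi>) (at U) (r U) \<noteq> 0"
proof -
  have \<alpha>: "fst (tangent V (r V)) = 0" if V: "V \<in> G" for V
  proof -
    have "vel k (\<Phi> V) + \<sigma> * sound X k (\<Phi> V) \<noteq> mix_vel (\<Phi> V)"
    proof -
      have "mix_vel (\<Phi> V) \<noteq> vel k (\<Phi> V) - sound X k (\<Phi> V)" "mix_vel (\<Phi> V) \<noteq> vel k (\<Phi> V) + sound X k (\<Phi> V)"
        using V by (auto simp: G out_of_resonance_def)
      then show ?thesis using \<sigma> by auto
    qed
    then show ?thesis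
      using quasilinear_eigenvector(1)[OF _ eig[OF V]] V by (auto simp: G)
  qed
  have UD: "U \<in> D" using U G by auto
  have "tangent U (r U) \<noteq> 0"
    using nz[OF U] bij_is_inj[OF bij_tangent[OF UD]] linear_injective_0[OF linear_tangent[OF UD]] by blast
  moreover have "phase_state j (tangent U (r U)) = 0" if "j \<noteq> k" for j
    by (rule acoustic_other_phase[OF G cont eig \<alpha> that U])
  ultimately have "phase_state k (tangent U (r U)) \<noteq> 0"
    using \<alpha>[OF U] state_eq_0_iff by metis
  then show ?thesis
    using \<sigma> by (intro acoustic_derivative[OF UD eig[OF U]] \<alpha>[OF U] fund thermo_dom admissible_\<Phi>[OF UD]) auto
qed

end

end

section \<open>The seven characteristic fields together\<close>

theorem proposition4p2:
  fixes X :: "phase \<Rightarrow> eos"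
    and \<Phi> :: "real^7 \<Rightarrow> state"
    and D G :: "(real^7) set"
    and r :: "wave \<Rightarrow> real^7 \<Rightarrow> real^7"
  assumes "\<And>k. complete_eos (X k)"
    and "state_variables X \<Phi> D"
    and "G = {U \<in> D. out_of_resonance X (\<Phi> U)}"
    and "eigenvector_fields X \<Phi> G r"
  shows "linearly_degenerate G (eigenvalue X Mixture \<circ> \<Phi>) (r Mixture) \<and>
    (\<forall>k. linearly_degenerate G (eigenvalue X (Convective k) \<circ> \<Phi>) (r (Convective k))) \<and>
    (\<forall>k. (\<forall>x\<in>eos_dom (X k). fundamental_derivative (X k) x \<noteq> 0) \<longrightarrow>
       genuinely_nonlinear G (eigenvalue X (Acoustic_minus k) \<circ> \<Phi>) (r (Acoustic_minus k)) \<and>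
       genuinely_nonlinear G (eigenvalue X (Acoustic_plus k) \<circ> \<Phi>) (r (Acoustic_plus k)))"
proof -
  interpret two_fluid X using assms(1) by unfold_locales
  note vars = assms(2)
  have GD: "U \<in> G \<Longrightarrow> U \<in> D" for U using assms(3) by auto
  have cont: "continuous_on G (r w)" for w
    using assms(4) smooth_on_imp_continuous_on by (auto simp: eigenvector_fields_def)
  have eig: "quasilinear_matrix X \<Phi> U *v r w U = eigenvalue X w (\<Phi> U) *\<^sub>R r w U" if "U \<in> G" for w U
    using assms(4) that by (auto simp: eigenvector_fields_def)
  \<comment> \<open>The eigenvectors form an independent set, which cannot contain 0.\<close>
  have nz: "r w U \<noteq> 0" if "U \<in> G" for w U
    using assms(4) that dependent_zero unfolding eigenvector_fields_def by (metis rangeI)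
  have diff: "(eigenvalue X w \<circ> \<Phi>) differentiable (at U)" if "U \<in> G" for w U
    using frechet_derivative_comp_\<Phi>(2)[OF vars GD[OF that]]
      differentiable_eigenvalue[OF admissible_\<Phi>[OF vars GD[OF that]]]
    unfolding differentiable_def by metis
  \<comment> \<open>Both signs are written as a coefficient of the sound speed, so that
    \<open>genuinely_nonlinear_acoustic\<close> applies with \<sigma> = -1 and \<sigma> = 1.\<close>
  have acoustic: "eigenvalue X (Acoustic_minus k) = (\<lambda>z. vel k z + (-1) * sound X k z)"
    "eigenvalue X (Acoustic_plus k) = (\<lambda>z. vel k z + 1 * sound X k z)" for k
    by auto
  have "linearly_degenerate G (eigenvalue X Mixture \<circ> \<Phi>) (r Mixture)"
    unfolding linearly_degenerate_def
    using diff linearly_degenerate_mixture[OF vars GD] eig[of _ Mixture] by simp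
  moreover have "linearly_degenerate G (eigenvalue X (Convective k) \<circ> \<Phi>) (r (Convective k))" for k
    unfolding linearly_degenerate_def
    using diff linearly_degenerate_convective[OF vars GD] eig[of _ "Convective k"] by simp
  moreover have "genuinely_nonlinear G (eigenvalue X (Acoustic_minus k) \<circ> \<Phi>) (r (Acoustic_minus k))"
    "genuinely_nonlinear G (eigenvalue X (Acoustic_plus k) \<circ> \<Phi>) (r (Acoustic_plus k))"
    if "\<forall>x\<in>eos_dom (X k). fundamental_derivative (X k) x \<noteq> 0" for k
  proof -
    have fund: "\<And>x. x \<in> eos_dom (X k) \<Longrightarrow> fundamental_derivative (X k) x \<noteq> 0"
      using that by blast
    show "genuinely_nonlinear G (eigenvalue X (Acoustic_minus k) \<circ> \<Phi>) (r (Acoustic_minus k))"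
      unfolding genuinely_nonlinear_def
    proof (intro ballI conjI diff)
      show "frechet_derivative (eigenvalue X (Acoustic_minus k) \<circ> \<Phi>) (at U) (r (Acoustic_minus k) U) \<noteq> 0"
        if "U \<in> G" for U
        unfolding acoustic
        by (rule genuinely_nonlinear_acoustic[OF vars assms(3) cont _ nz _ fund that])
          (simp_all add: eig)
    qed
    show "genuinely_nonlinear G (eigenvalue X (Acoustic_plus k) \<circ> \<Phi>) (r (Acoustic_plus k))"
      unfolding genuinely_nonlinear_def
    proof (intro ballI conjI diff)
      show "frechet_derivative (eigenvalue X (Acoustic_plus k) \<circ> \<Phi>) (at U) (r (Acoustic_plus k) U) \<noteq> 0"
        if "U \<in> G" for U
        unfolding acoustic
        by (rule genuinely_nonlinear_acoustic[OF vars assms(3) cont _ nz _ fund that])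
          (simp_all add: eig)
    qed
  qed
  ultimately show ?thesis by blast
qed

end
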